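(* Let $\Delta = d+1 \ge 3$ be an integer and $\delta\in(0,1)$. Consider the hardcore model on a graph $G=(V,E)$ of maximum degree $\Delta$ with fugacity $\lambda = (1-\delta)\lambda_c(\Delta)$, where $\lambda_c(\Delta) = \frac{(\Delta-1)^{\Delta-1}}{(\Delta-2)^{\Delta}}$. Then the Gibbs distribution $\mu_{G,\lambda}$ satisfies $\ell_\infty$-spectral independence with constant $$C^\infty_{\mathsf{SI}} = \frac{1+\hat{x}}{1-d\hat{x}} \le \frac{2}{\delta}\left(1+\frac{2}{d-1}\right),$$ where $\hat x = \hat x(d,\lambda)\in(0,1/d)$ is the unique fixed point in $[0,1]$ of the function $F_{d,\lambda}(x) = \frac{\lambda(1-x)^d}{1+\lambda(1-x)^d}$.
   Context: The hardcore model on $G$ with fugacity $\lambda>0$ is the distribution $\mu_{G,\lambda}(\sigma)\propto\lambda^{|\sigma|}$ over independent sets $\sigma$ of $G$, viewed as a distribution over $\{0,1\}^V$ (indicator vectors). For a distribution $\mu$ over $\{0,1\}^n$, let $A_\mu$ be the set of coordinates $i$ with $\Pr_\mu[\sigma_i=0]>0$ and $\Pr_\mu[\sigma_i=1]>0$; for $i,j\in A_\mu$ the influence is $\Psi_\mu(i,j)=\Pr_\mu[\sigma_j=1\mid\sigma_i=1]-\Pr_\mu[\sigma_j=1\mid\sigma_i=0]$. A pinning is a partial configuration $\tau\in\{0,1\}^\Lambda$, $\Lambda\subseteq[n]$, with $\Pr_\mu[\sigma_\Lambda=\tau]>0$, and $\mu^\tau$ is $\mu$ conditioned on $\sigma_\Lambda=\tau$.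 $\mu$ satisfies $\ell_\infty$-spectral independence with constant $C$ if for every pinning $\tau$, $\max_{i\in A_{\mu^\tau}}\sum_{j\in A_{\mu^\tau}}|\Psi_{\mu^\tau}(i,j)|\le C$. *)

theory Defs
  imports "HOL-Probability.Probability" "HOL-Library.Ramsey"
begin

text \<open>
  Finite simple graphs are given by a vertex set and a set of two-element edges;
  independent sets are those of \<^theory>\<open>HOL-Library.Ramsey\<close> (\<^const>\<open>indep\<close>).
\<close>

definition simple_graph :: "'a set \<Rightarrow> 'a set set \<Rightarrow> bool" where
  "simple_graph V E \<longleftrightarrow> finite V \<and> (\<forall>e\<in>E. e \<subseteq> V \<and> card e = 2)"

definition vertex_degree :: "'a set set \<Rightarrow> 'a \<Rightarrow> nat" where
  "vertex_degree E v = card {e \<in> E. v \<in> e}"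

text \<open>
  A configuration in \<open>{0,1}\<^sup>V\<close> is a function \<open>'a \<Rightarrow> bool\<close> (\<open>True\<close> is 1). The hardcore
  distribution is supported on indicator functions of independent subsets of \<open>V\<close>; in
  particular its configurations are \<open>False\<close> outside \<open>V\<close>.
\<close>

definition indep_sets_of :: "'a set \<Rightarrow> 'a set set \<Rightarrow> 'a set set" where
  "indep_sets_of V E = {S. S \<subseteq> V \<and> indep S E}"

definition partition_function :: "'a set \<Rightarrow> 'a set set \<Rightarrow> real \<Rightarrow> real" where
  "partition_function V E lam = (\<Sum>S\<in>indep_sets_of V E. lam ^ card S)"

definition hardcore :: "'a set \<Rightarrow> 'a set set \<Rightarrow> real \<Rightarrow> ('a \<Rightarrow> bool) pmf" where
  "hardcore V E lam = embed_pmf (\<lambda>\<sigma>.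
     if {v. \<sigma> v} \<in> indep_sets_of V E
     then lam ^ card {v. \<sigma> v} / partition_function V E lam else 0)"

text \<open>The weights above do form a probability mass function.\<close>

lemma pmf_hardcore:
  fixes V :: "'a set"
  assumes "simple_graph V E" and "lam > 0"
  shows "pmf (hardcore V E lam) \<sigma> =
    (if {v. \<sigma> v} \<in> indep_sets_of V E
     then lam ^ card {v. \<sigma> v} / partition_function V E lam else 0)"
proof -
  let ?I = "indep_sets_of V E" and ?Z = "partition_function V E lam"
  let ?f = "\<lambda>\<sigma>. if {v. \<sigma> v} \<in> ?I then lam ^ card {v. \<sigma> v} / ?Z else 0"
  let ?C = "(\<lambda>S v. v \<in> S) ` ?I"
  have fin: "finite ?I"
    using assms(1) unfolding indep_sets_of_def simple_graph_def
    by (auto intro: finite_subset[of _ "Pow V"])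
  have "{} \<in> ?I" by (simp add: indep_sets_of_def)
  then have Z: "?Z > 0"
    unfolding partition_function_def using fin assms(2)
    by (intro sum_pos) auto
  have nonneg: "0 \<le> ?f \<sigma>" for \<sigma> using Z assms(2) by simp
  have C: "\<sigma> \<in> ?C" if "?f \<sigma> \<noteq> 0" for \<sigma>
  proof
    show "\<sigma> = (\<lambda>v. v \<in> {v. \<sigma> v})" by simp
    show "{v. \<sigma> v} \<in> ?I" using that by (simp split: if_splits)
  qed
  have inj: "inj_on (\<lambda>S v. v \<in> S) ?I"
    by (auto simp: inj_on_def fun_eq_iff)
  have "(\<Sum>\<sigma>\<in>?C. ?f \<sigma>) = (\<Sum>S\<in>?I. lam ^ card S / ?Z)"
    by (subst sum.reindex[OF inj]) (auto intro!: sum.cong)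
  also have "\<dots> = 1"
    using Z by (simp add: sum_divide_distrib[symmetric] partition_function_def)
  finally have sum1: "(\<Sum>\<sigma>\<in>?C. ?f \<sigma>) = 1" .
  have "(\<integral>\<^sup>+\<sigma>. ennreal (?f \<sigma>) \<partial>count_space UNIV) = (\<Sum>\<sigma>\<in>?C. ennreal (?f \<sigma>))"
  proof (rule nn_integral_count_space')
    show "finite ?C" using fin by simp
    fix \<sigma> assume "\<sigma> \<notin> ?C"
    then have "?f \<sigma> = 0" using C[of \<sigma>] by argo
    then show "ennreal (?f \<sigma>) = 0" by (simp only: ennreal_0)
  qed simp
  also have "\<dots> = 1"
    using sum1 nonneg by (subst sum_ennreal) auto
  finally have "(\<integral>\<^sup>+\<sigma>. ennreal (?f \<sigma>) \<partial>count_space UNIV) = 1" .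
  then show ?thesis
    unfolding hardcore_def using nonneg by (intro pmf_embed_pmf)
qed

text \<open>
  For a distribution \<open>\<mu>\<close> on configurations, \<open>I\<close> is the finite set of coordinates.
\<close>

definition free_coords :: "'a set \<Rightarrow> ('a \<Rightarrow> bool) pmf \<Rightarrow> 'a set" where
  "free_coords I \<mu> =
     {i \<in> I. \<P>(\<sigma> in measure_pmf \<mu>. \<not> \<sigma> i) > 0 \<and> \<P>(\<sigma> in measure_pmf \<mu>. \<sigma> i) > 0}"

definition influence :: "('a \<Rightarrow> bool) pmf \<Rightarrow> 'a \<Rightarrow> 'a \<Rightarrow> real" where
  "influence \<mu> i j =
     \<P>(\<sigma> in measure_pmf \<mu>. \<sigma> j \<bar> \<sigma> i) - \<P>(\<sigma> in measure_pmf \<mu>. \<sigma> j \<bar> \<not> \<sigma> i)"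

text \<open>
  A pinning is given by its domain \<open>\<Lambda>\<close> and a function \<open>\<tau>\<close> of which only the values on
  \<open>\<Lambda>\<close> matter.
\<close>

definition agreeing :: "'a set \<Rightarrow> ('a \<Rightarrow> bool) \<Rightarrow> ('a \<Rightarrow> bool) set" where
  "agreeing \<Lambda> \<tau> = {\<sigma>. \<forall>i\<in>\<Lambda>. \<sigma> i = \<tau> i}"

definition pinning :: "'a set \<Rightarrow> ('a \<Rightarrow> bool) pmf \<Rightarrow> 'a set \<Rightarrow> ('a \<Rightarrow> bool) \<Rightarrow> bool" where
  "pinning I \<mu> \<Lambda> \<tau> \<longleftrightarrow> \<Lambda> \<subseteq> I \<and> measure_pmf.prob \<mu> (agreeing \<Lambda> \<tau>) > 0"

definition pinned :: "('a \<Rightarrow> bool) pmf \<Rightarrow> 'a set \<Rightarrow> ('a \<Rightarrow> bool) \<Rightarrow> ('a \<Rightarrow> bool) pmf" where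
  "pinned \<mu> \<Lambda> \<tau> = cond_pmf \<mu> (agreeing \<Lambda> \<tau>)"

text \<open>
  The bound on the maximum over \<open>i\<close> is stated for each \<open>i\<close>, so it is vacuous for pinnings
  that leave no free coordinate.
\<close>

definition linf_spectral_independence :: "'a set \<Rightarrow> ('a \<Rightarrow> bool) pmf \<Rightarrow> real \<Rightarrow> bool" where
  "linf_spectral_independence I \<mu> C \<longleftrightarrow>
     (\<forall>\<Lambda> \<tau>. pinning I \<mu> \<Lambda> \<tau> \<longrightarrow>
        (\<forall>i\<in>free_coords I (pinned \<mu> \<Lambda> \<tau>).
           (\<Sum>j\<in>free_coords I (pinned \<mu> \<Lambda> \<tau>). \<bar>influence (pinned \<mu> \<Lambda> \<tau>) i j\<bar>) \<le> C))"

definition lambda_c :: "nat \<Rightarrow> real" where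
  "lambda_c \<Delta> = (real \<Delta> - 1) ^ (\<Delta> - 1) / (real \<Delta> - 2) ^ \<Delta>"

definition F_hc :: "nat \<Rightarrow> real \<Rightarrow> real \<Rightarrow> real" where
  "F_hc d lam x = lam * (1 - x) ^ d / (1 + lam * (1 - x) ^ d)"

definition xhat :: "nat \<Rightarrow> real \<Rightarrow> real" where
  "xhat d lam = (THE x. x \<in> {0..1} \<and> F_hc d lam x = x)"

end

theory Submission
  imports Defs
begin

text \<open>
  Pinning a vertex to 0 deletes it, and pinning it to 1 deletes it with its neighbours, so it
  suffices to bound the total influence \<open>T(W, v)\<close> of a vertex in every induced subgraph \<open>W\<close>.
  Deleting the neighbours \<open>u\<^sub>1, u\<^sub>2, \<dots>\<close> of \<open>v\<close> one after the other from \<open>W - v\<close>, and writing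
  \<open>p\<^sub>i\<close> for the marginal of \<open>u\<^sub>i\<close> just before its deletion, gives
  \<open>T(W, v) \<le> 1 + \<Sum>\<^sub>i p\<^sub>i T(W\<^sub>i, u\<^sub>i)\<close> and \<open>p / (1 - p) = \<lambda> \<Prod>\<^sub>i (1 - p\<^sub>i)\<close> for the marginal \<open>p\<close> of \<open>v\<close>;
  this is Weitz' recursion without the self-avoiding walk tree.

  Let \<open>M = 1 / (1 - d x)\<close> with \<open>x\<close> the fixed point. If \<open>v\<close> has at most \<open>d\<close> neighbours, then by
  induction \<open>T \<le> M\<close> and \<open>p T \<le> x M\<close>. The first bound follows from the second one for the \<open>u\<^sub>i\<close>,
  as \<open>1 + d x M = M\<close>. For the second bound, \<open>T \<le> 1 + M \<Sum>\<^sub>i p\<^sub>i\<close>, and \<open>p (1 + M \<Sum>\<^sub>i p\<^sub>i) \<le> x M\<close> amounts to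
  \<open>(1 - (d + 1) x + \<Sum>\<^sub>i p\<^sub>i) \<Prod>\<^sub>i (1 - p\<^sub>i) \<le> (1 - x) ^ (d + 1)\<close>, which is AM-GM. A vertex with \<open>d + 1\<close>
  neighbours then has \<open>T \<le> 1 + (d + 1) x M = (1 + x) / (1 - d x)\<close>.
\<close>

section \<open>The fixed point\<close>

lemma F_hc_fixed_iff:
  assumes "lam > 0" and "x \<in> {0..1}"
  shows "F_hc d lam x = x \<longleftrightarrow> lam * (1 - x) ^ (d + 1) = x"
proof -
  have "lam * (1 - x) ^ d \<ge> 0" using assms by simp
  then have "1 + lam * (1 - x) ^ d \<noteq> 0" by linarith
  then show ?thesis unfolding F_hc_def by (auto simp: field_simps)
qed

text \<open>At the critical fugacity the fixed point is exactly \<open>1 / d\<close>. Comparing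
  \<open>lam\<close> with \<open>lambda_c\<close> therefore locates the fixed point relative to
  \<open>1 / d\<close>.\<close>

lemma lambda_c_mult_power:
  assumes "d \<ge> 2"
  shows "lambda_c (d + 1) * (1 - 1 / real d) ^ (d + 1) = 1 / real d"
proof -
  have "1 - 1 / real d = (real d - 1) / real d" using assms by (simp add: field_simps)
  moreover have "(real d - 1) ^ (d + 1) > 0" using assms by simp
  ultimately show ?thesis
    using assms by (simp add: lambda_c_def power_divide divide_simps)
qed

lemma lambda_c_pos: "d \<ge> 2 \<Longrightarrow> lambda_c (d + 1) > 0"
  by (simp add: lambda_c_def)

text \<open>In the polynomial form of the fixed point equation, the difference \<open>h\<close> of
  the two sides is strictly increasing up to 1, negative at 0 and, below criticality, positive at
  \<open>1 / d\<close>.\<close>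

lemma fixed_point_unique_exists:
  assumes d: "d \<ge> 2" and lam: "0 < lam" "lam < lambda_c (d + 1)"
  obtains x where "x \<in> {0<..<1 / real d}" "lam * (1 - x) ^ (d + 1) = x"
    "\<And>y. y \<in> {0..1} \<Longrightarrow> F_hc d lam y = y \<longleftrightarrow> y = x"
proof -
  define h where "h = (\<lambda>x. x - lam * (1 - x) ^ (d + 1))"
  have mono: "h x < h y" if "x < y" "y \<le> 1" for x y
  proof -
    have "(1 - y) ^ (d + 1) \<le> (1 - x) ^ (d + 1)" using that by (intro power_mono) auto
    then have "lam * (1 - y) ^ (d + 1) \<le> lam * (1 - x) ^ (d + 1)" using lam by simp
    then show ?thesis using that(1) unfolding h_def by linarith
  qed
  have h0: "h 0 < 0" using lam by (simp add: h_def)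
  have "(1 - 1 / real d) ^ (d + 1) > 0" using d by simp
  then have "lam * (1 - 1 / real d) ^ (d + 1) < lambda_c (d + 1) * (1 - 1 / real d) ^ (d + 1)"
    using lam(2) by (rule mult_strict_right_mono[rotated])
  then have h1: "h (1 / real d) > 0"
    unfolding lambda_c_mult_power[OF d] h_def by simp
  have "\<exists>x\<ge>0. x \<le> 1 / real d \<and> h x = 0"
    using h0 h1 by (intro IVT') (auto simp: h_def intro!: continuous_intros)
  then obtain x where x: "0 \<le> x" "x \<le> 1 / real d" "h x = 0" by blast
  with h0 h1 have x01: "x \<in> {0<..<1 / real d}" by (cases "x = 0"; cases "x = 1 / real d") auto
  have "1 / real d \<le> 1" using d by simp
  then have x1: "x \<le> 1" using x by linarith
  have uniq: "y = x" if "h y = 0" "y \<le> 1" for y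
    using mono[of x y] mono[of y x] that x x1 by (cases x y rule: linorder_cases) auto
  have "F_hc d lam y = y \<longleftrightarrow> y = x" if "y \<in> {0..1}" for y
  proof -
    have "F_hc d lam y = y \<longleftrightarrow> h y = 0"
      unfolding F_hc_fixed_iff[OF lam(1) that] h_def by linarith
    then show ?thesis using uniq[of y] that x(3) by auto
  qed
  moreover have "lam * (1 - x) ^ (d + 1) = x" using x(3) unfolding h_def by linarith
  ultimately show ?thesis using that[OF x01] by blast
qed

section \<open>Bounding the constant in terms of \<open>\<delta>\<close>\<close>

text \<open>If the left side is positive and \<open>n > 0\<close>, then \<open>t < 1\<close>, and
  Bernoulli bounds it by \<open>(1 - t) ^ n\<close>; multiplying by \<open>(1 + t) ^ n\<close>
  leaves a power of \<open>1 - t\<^sup>2\<close>.\<close>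

lemma one_minus_le_inverse_power:
  fixes t :: real
  assumes "t \<ge> 0"
  shows "1 - real n * t \<le> 1 / (1 + t) ^ n"
proof -
  show ?thesis
  proof (cases "1 - real n * t \<le> 0")
    case False
    have "(1 - real n * t) * (1 + t) ^ n \<le> 1"
    proof -
      have t: "real n * t < 1" using False by simp
      show ?thesis
      proof (cases "n = 0")
        case False
        then have "t \<le> real n * t" using assms by (simp add: mult_le_cancel_right1)
        then have "t < 1" using t by linarith
        then have "1 - real n * t \<le> (1 - t) ^ n"
          using Bernoulli_inequality[of "- t" n] by simp
        then have "(1 - real n * t) * (1 + t) ^ n \<le> (1 - t) ^ n * (1 + t) ^ n"
          using assms by (intro mult_right_mono) auto
        also have "\<dots> = (1 - t\<^sup>2) ^ n"
          by (simp add: power_mult_distrib[symmetric] algebra_simps power2_eq_square)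
        also have "\<dots> \<le> 1"
          using assms \<open>t < 1\<close> by (intro power_le_one) (auto simp: power_le_one)
        finally show ?thesis .
      qed simp
    qed
    then show ?thesis using assms by (simp add: pos_le_divide_eq)
  next
    case True
    also have "0 \<le> 1 / (1 + t) ^ n" using assms by simp
    finally show ?thesis .
  qed
qed

text \<open>Dividing the fixed point equation by its critical instance gives
  \<open>(1 - \<delta>) * (1 + t) ^ (d + 1) = y\<close>. Linearizing in \<open>t\<close> shows that
  \<open>\<delta>\<close> is at most a bounded multiple of the gap \<open>1 - y\<close>.\<close>

lemma spectral_constant_le:
  assumes d: "d \<ge> 2" and \<delta>: "0 < \<delta>" "\<delta> < 1"
    and x: "x \<in> {0<..<1 / real d}" "(1 - \<delta>) * lambda_c (d + 1) * (1 - x) ^ (d + 1) = x"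
  shows "(1 + x) / (1 - real d * x) \<le> 2 / \<delta> * (1 + 2 / (real d - 1))"
proof -
  define y where "y = real d * x"
  \<comment> \<open>Chosen so that \<open>1 - x\<close> is \<open>1 + t\<close> times its critical
    value \<open>1 - 1 / d\<close>.\<close>
  define t where "t = (1 - y) / (real d - 1)"
  define D where "D = real d"
  have D: "D \<ge> 2" using d by (simp add: D_def)
  have y: "0 < y" "y < 1" using x(1) d by (auto simp: y_def field_simps)
  then have t: "t > 0" using d by (simp add: t_def)
  have xy: "x = y / D" using d by (simp add: y_def D_def)
  have "1 - x = (1 - 1 / real d) * (1 + t)"
    using D unfolding xy t_def D_def by (simp add: field_simps)
  then have "(1 - \<delta>) * (lambda_c (d + 1) * (1 - 1 / real d) ^ (d + 1)) * (1 + t) ^ (d + 1) = x"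
    using x(2) by (simp only: power_mult_distrib mult.assoc)
  then have "(1 - \<delta>) * (1 + t) ^ (d + 1) = y"
    unfolding lambda_c_mult_power[OF d] using d by (auto simp: y_def)
  then have "(1 - \<delta>) * (1 + t) ^ (d + 1) / (1 + t) ^ (d + 1) = y / (1 + t) ^ (d + 1)" by simp
  then have "1 - \<delta> = y * (1 / (1 + t) ^ (d + 1))" using t by simp
  also have "\<dots> \<ge> y * (1 - real (d + 1) * t)"
    using y t by (intro mult_left_mono one_minus_le_inverse_power) auto
  finally have "\<delta> \<le> 1 - y * (1 - (D + 1) * t)" by (simp add: D_def add.commute)
  also have "\<dots> = (1 - y) * (1 + y * (D + 1) / (D - 1))"
    using D by (simp add: t_def D_def[symmetric] field_simps)
  finally have "\<delta> * (1 + x) \<le> (1 - y) * (1 + y * (D + 1) / (D - 1)) * (1 + x)"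
    using x by (intro mult_right_mono) auto
  also have "\<dots> = (1 - y) * ((1 + y * ((D + 1) / (D - 1))) * (1 + y / D))"
    by (simp add: xy)
  \<comment> \<open>Every \<open>y\<close> outside the gap \<open>1 - y\<close> is replaced by its
    upper bound 1.\<close>
  also have "\<dots> \<le> (1 - y) * ((1 + 1 * ((D + 1) / (D - 1))) * (1 + 1 / D))"
    using y D by (intro mult_left_mono mult_mono add_left_mono mult_right_mono divide_right_mono) auto
  also have "(1 + 1 * ((D + 1) / (D - 1))) * (1 + 1 / D) = 2 * (1 + 2 / (D - 1))"
    using D by (simp add: field_simps)
  finally have "\<delta> * (1 + x) \<le> (1 - y) * (2 * (1 + 2 / (D - 1)))" .
  then have "(1 + x) / (1 - y) \<le> 2 * (1 + 2 / (D - 1)) / \<delta>"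
    using y \<delta> by (simp add: divide_simps mult.commute)
  then show ?thesis unfolding y_def D_def by simp
qed

section \<open>An AM-GM inequality\<close>

text \<open>AM-GM for the numbers \<open>c\<close>, \<open>1 - p u\<close> and \<open>d - card B\<close> copies of \<open>1\<close>, whose mean is \<open>a\<close>.\<close>

lemma mult_prod_le_power_mean:
  fixes p :: "'a \<Rightarrow> real"
  assumes B: "finite B" "card B \<le> d" and p: "\<And>u. u \<in> B \<Longrightarrow> p u \<le> 1" and a: "a > 0"
    and c: "c + real d - (\<Sum>u\<in>B. p u) = (real d + 1) * a"
  shows "c * (\<Prod>u\<in>B. 1 - p u) \<le> a ^ (d + 1)"
proof (cases "c \<le> 0")
  case True
  have "(\<Prod>u\<in>B. 1 - p u) \<ge> 0" using p by (intro prod_nonneg) auto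
  then have "c * (\<Prod>u\<in>B. 1 - p u) \<le> 0" using True by (intro mult_nonpos_nonneg)
  also have "\<dots> \<le> a ^ (d + 1)" using a by simp
  finally show ?thesis .
next
  case False
  \<comment> \<open>AM-GM by way of \<open>1 + z \<le> exp z\<close>: each number divided by the
    mean is at most an exponential, and the exponents add up to 0.\<close>
  have le_exp: "t / a \<le> exp (t / a - 1)" for t
    using exp_ge_add_one_self[of "t / a - 1"] by simp
  have card: "real (d - card B) = real d - real (card B)" using B by simp
  have "(c / a) * ((\<Prod>u\<in>B. (1 - p u) / a) * (1 / a) ^ (d - card B))
      \<le> exp (c / a - 1) * ((\<Prod>u\<in>B. exp ((1 - p u) / a - 1)) * exp (1 / a - 1) ^ (d - card B))"
    using False p a le_exp
    by (intro mult_mono prod_mono power_mono conjI mult_nonneg_nonneg prod_nonneg) auto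
  also have "\<dots> = exp ((c / a - 1) + ((\<Sum>u\<in>B. (1 - p u) / a - 1) + real (d - card B) * (1 / a - 1)))"
    using B(1) by (simp add: exp_add exp_sum exp_of_nat_mult)
  also have "(c / a - 1) + ((\<Sum>u\<in>B. (1 - p u) / a - 1) + real (d - card B) * (1 / a - 1))
      = (c + real d - (\<Sum>u\<in>B. p u)) / a - (real d + 1)"
    unfolding card sum_subtractf sum_divide_distrib[symmetric] using a
    by (simp add: field_simps)
  also have "\<dots> = 0" unfolding c using a by simp
  finally have "(c / a) * ((\<Prod>u\<in>B. (1 - p u) / a) * (1 / a) ^ (d - card B)) \<le> 1" by simp
  moreover have "(c / a) * ((\<Prod>u\<in>B. (1 - p u) / a) * (1 / a) ^ (d - card B))
      = c * (\<Prod>u\<in>B. 1 - p u) / a ^ (1 + (card B + (d - card B)))"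
    by (simp add: prod_dividef power_add power_divide del: le_add_diff_inverse)
  ultimately have "c * (\<Prod>u\<in>B. 1 - p u) / a ^ (d + 1) \<le> 1" using B(2) by simp
  then show ?thesis using a by (simp add: pos_divide_le_eq)
qed

section \<open>Influence decay on induced subgraphs\<close>

locale hardcore_weights =
  fixes E :: "'a set set" and lam :: real
  assumes edge_card: "\<And>e. e \<in> E \<Longrightarrow> card e = 2" and lam_pos: "lam > 0"
begin

text \<open>An induced subgraph is represented by its vertex set \<open>W\<close> alone, with
  \<open>E\<close> kept fixed, since edges leaving \<open>W\<close> do not constrain subsets of
  \<open>W\<close>.\<close>

abbreviation Z :: "'a set \<Rightarrow> real" where
  "Z W \<equiv> partition_function W E lam"

definition nbrs :: "'a \<Rightarrow> 'a set" where
  "nbrs v = {u. {v, u} \<in> E}"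

text \<open>The probability that \<open>v\<close> is occupied, as \<open>Z (W - {v})\<close> is the
  weight of the configurations with \<open>v\<close> empty. It is 0 for \<open>v\<close> outside a
  finite \<open>W\<close>, so sums may range over larger sets.\<close>

definition marginal :: "'a set \<Rightarrow> 'a \<Rightarrow> real" where
  "marginal W v = 1 - Z (W - {v}) / Z W"

text \<open>Occupying \<open>v\<close> leaves the graph \<open>W - {v} - nbrs v\<close> and emptying
  it leaves \<open>W - {v}\<close>, so each summand is the absolute influence of \<open>v\<close> on
  \<open>j\<close>. The leading 1 is the influence of \<open>v\<close> on itself.\<close>

definition total_influence :: "'a set \<Rightarrow> 'a \<Rightarrow> real" where
  "total_influence W v =
     1 + (\<Sum>j\<in>W - {v}. \<bar>marginal (W - {v} - nbrs v) j - marginal (W - {v}) j\<bar>)"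

section \<open>Recursions for partition functions and marginals\<close>

lemma nbrs_sym: "u \<in> nbrs v \<longleftrightarrow> v \<in> nbrs u"
  by (simp add: nbrs_def insert_commute)

lemma not_in_own_nbrs: "v \<notin> nbrs v"
  using edge_card[of "{v}"] by (auto simp: nbrs_def)

lemma finite_indep_sets: "finite W \<Longrightarrow> finite (indep_sets_of W E)"
  by (rule finite_subset[of _ "Pow W"]) (auto simp: indep_sets_of_def)

lemma indep_iff_nbrs: "indep S E \<longleftrightarrow> (\<forall>v\<in>S. S \<inter> nbrs v = {})"
  using not_in_own_nbrs unfolding indep_def nbrs_def by fastforce

lemma Z_pos: "finite W \<Longrightarrow> Z W > 0"
  unfolding partition_function_def using lam_pos finite_indep_sets
  by (intro sum_pos) (auto simp: indep_sets_of_def intro!: exI[of _ "{}"])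

lemma sum_indep_sets_avoiding:
  "(\<Sum>S\<in>{S\<in>indep_sets_of W E. v \<notin> S}. f S) = (\<Sum>S\<in>indep_sets_of (W - {v}) E. f S)"
  by (rule sum.cong) (auto simp: indep_sets_of_def)

lemma sum_indep_sets_containing:
  assumes "v \<in> W"
  shows "(\<Sum>S\<in>{S\<in>indep_sets_of W E. v \<in> S}. f S)
    = (\<Sum>S\<in>indep_sets_of (W - {v} - nbrs v) E. f (insert v S))"
proof (rule sum.reindex_bij_witness[where i = "insert v" and j = "\<lambda>S. S - {v}"])
  fix S assume "S \<in> {S \<in> indep_sets_of W E. v \<in> S}"
  then show "S - {v} \<in> indep_sets_of (W - {v} - nbrs v) E"
    by (auto simp: indep_sets_of_def indep_iff_nbrs)
next
  fix S assume "S \<in> indep_sets_of (W - {v} - nbrs v) E"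
  then show "insert v S \<in> {S \<in> indep_sets_of W E. v \<in> S}"
    using assms not_in_own_nbrs nbrs_sym by (auto simp: indep_sets_of_def indep_iff_nbrs)
qed (auto simp: indep_sets_of_def insert_absorb)

lemma weight_containing:
  assumes "finite W" "v \<in> W"
  shows "(\<Sum>S\<in>{S\<in>indep_sets_of W E. v \<in> S}. lam ^ card S) = lam * Z (W - {v} - nbrs v)"
proof -
  have "lam ^ card (insert v S) = lam * lam ^ card S"
    if "S \<in> indep_sets_of (W - {v} - nbrs v) E" for S
  proof -
    have "finite S" "v \<notin> S"
      using that assms(1) by (auto simp: indep_sets_of_def intro: finite_subset)
    then show ?thesis by simp
  qed
  then show ?thesis
    unfolding sum_indep_sets_containing[OF assms(2)] partition_function_def sum_distrib_left
    by (intro sum.cong) auto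
qed

lemma weight_containing_eq_diff:
  assumes "finite W"
  shows "(\<Sum>S\<in>{S\<in>indep_sets_of W E. v \<in> S}. lam ^ card S) = Z W - Z (W - {v})"
proof -
  have "Z W = (\<Sum>S\<in>{S\<in>indep_sets_of W E. v \<in> S} \<union> {S\<in>indep_sets_of W E. v \<notin> S}. lam ^ card S)"
    unfolding partition_function_def by (intro sum.cong) auto
  also have "\<dots> = (\<Sum>S\<in>{S\<in>indep_sets_of W E. v \<in> S}. lam ^ card S) + Z (W - {v})"
    unfolding partition_function_def sum_indep_sets_avoiding[symmetric]
    using finite_indep_sets[OF assms] by (intro sum.union_disjoint) auto
  finally show ?thesis by simp
qed

lemma Z_recursion:
  assumes "finite W" "v \<in> W"
  shows "Z W = Z (W - {v}) + lam * Z (W - {v} - nbrs v)"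
  using weight_containing[OF assms] weight_containing_eq_diff[OF assms(1), of v] by simp

lemma marginal_bounds:
  assumes "finite W"
  shows "0 \<le> marginal W v" "marginal W v \<le> 1"
proof -
  have "Z (W - {v}) \<le> Z W"
    using Z_recursion[OF assms, of v] Z_pos[of "W - {v} - nbrs v"] lam_pos assms
    by (cases "v \<in> W") (auto simp: less_imp_le)
  then show "0 \<le> marginal W v" "marginal W v \<le> 1"
    using Z_pos[of W] Z_pos[of "W - {v}"] assms by (auto simp: marginal_def divide_simps)
qed

lemma marginal_outside: "finite W \<Longrightarrow> v \<notin> W \<Longrightarrow> marginal W v = 0"
  using Z_pos[of W] by (simp add: marginal_def)

lemma Z_remove: "finite W \<Longrightarrow> Z (W - {v}) = Z W * (1 - marginal W v)"
  using Z_pos[of W] by (simp add: marginal_def)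

text \<open>Law of total probability: the marginal of \<open>j\<close> in \<open>W\<close> averages
  its values for \<open>v\<close> occupied and \<open>v\<close> empty, with weight
  \<open>marginal W v\<close> on the former.\<close>

lemma marginal_remove_diff:
  assumes "finite W" "v \<in> W" "j \<noteq> v"
  shows "marginal (W - {v}) j - marginal W j
    = - marginal W v * (marginal (W - {v} - nbrs v) j - marginal (W - {v}) j)"
proof (cases "j \<in> W")
  case True
  define Y where "Y = W - {v} - nbrs v"
  have fin: "finite (W - {v})" "finite Y" using assms by (auto simp: Y_def)
  have pos: "Z W > 0" "Z (W - {v}) > 0" "Z Y > 0" using Z_pos assms fin by auto
  have 1: "Z W = Z (W - {v}) + lam * Z Y" using Z_recursion assms by (simp add: Y_def)
  have "W - {j} - {v} = W - {v} - {j}" "W - {j} - {v} - nbrs v = Y - {j}" by (auto simp: Y_def)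
  then have 2: "Z (W - {j}) = Z (W - {v} - {j}) + lam * Z (Y - {j})"
    using Z_recursion[of "W - {j}" v] assms by simp
  have "marginal W v = lam * Z Y / Z W"
    using pos 1 by (simp add: marginal_def field_simps)
  \<comment> \<open>Here \<open>w\<close>, \<open>a\<close>, \<open>b\<close> stand for the
    partition functions of \<open>W\<close>, \<open>W - {v}\<close> and \<open>Y\<close>;
    \<open>A\<close> and \<open>B\<close> are those of the last two with \<open>j\<close>
    deleted.\<close>
  moreover have "1 - A / a - (1 - (A + lam * B) / w) = - (lam * b / w) * (1 - B / b - (1 - A / a))"
    if "w > 0" "a > 0" "b > 0" "w = a + lam * b" for A B a b w
    using that(1-3) by (simp add: divide_simps) (simp add: that(4) algebra_simps)
  ultimately show ?thesis
    using pos 1 unfolding Y_def[symmetric] marginal_def[of _ j] 2 by simp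
qed (use assms in \<open>simp add: marginal_outside\<close>)

text \<open>The term \<open>j = v\<close> contributes \<open>marginal W v\<close>, matching the
  leading 1 of \<open>total_influence\<close>; the other terms come from
  \<open>marginal_remove_diff\<close>.\<close>

lemma sum_marginal_remove:
  assumes "finite W" "v \<in> W"
  shows "(\<Sum>j\<in>W. \<bar>marginal (W - {v}) j - marginal W j\<bar>) = marginal W v * total_influence W v"
proof -
  have "(\<Sum>j\<in>W. \<bar>marginal (W - {v}) j - marginal W j\<bar>) = \<bar>marginal (W - {v}) v - marginal W v\<bar>
      + (\<Sum>j\<in>W - {v}. \<bar>marginal (W - {v}) j - marginal W j\<bar>)"
    using assms by (simp add: sum.remove)
  also have "\<bar>marginal (W - {v}) v - marginal W v\<bar> = marginal W v"
    using marginal_bounds[of W v] assms by (simp add: marginal_outside)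
  also have "(\<Sum>j\<in>W - {v}. \<bar>marginal (W - {v}) j - marginal W j\<bar>) =
      (\<Sum>j\<in>W - {v}. marginal W v * \<bar>marginal (W - {v} - nbrs v) j - marginal (W - {v}) j\<bar>)"
    using marginal_remove_diff[OF assms] marginal_bounds[OF assms(1), of v]
    by (intro sum.cong) (auto simp: abs_mult)
  finally show ?thesis
    by (simp add: total_influence_def sum_distrib_left distrib_left)
qed

section \<open>Telescoping over neighbours and the inductive bounds\<close>

text \<open>
  Deleting the vertices of \<open>B\<close> one at a time telescopes both the partition function and the
  marginals; \<open>p u\<close> is the marginal of \<open>u\<close> at the moment it is deleted.
\<close>

lemma remove_set_marginals:
  assumes "finite B" "finite X" "B \<subseteq> X"
    and "\<And>Y u. Y \<subseteq> X \<Longrightarrow> u \<in> B \<Longrightarrow> u \<in> Y \<Longrightarrow>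
      total_influence Y u \<le> M \<and> marginal Y u * total_influence Y u \<le> K"
  shows "\<exists>p. (\<forall>u\<in>B. 0 \<le> p u \<and> p u \<le> 1) \<and> Z (X - B) = Z X * (\<Prod>u\<in>B. 1 - p u)
    \<and> (\<Sum>j\<in>X. \<bar>marginal (X - B) j - marginal X j\<bar>) \<le> M * (\<Sum>u\<in>B. p u)
    \<and> (\<Sum>j\<in>X. \<bar>marginal (X - B) j - marginal X j\<bar>) \<le> real (card B) * K"
  using assms
proof (induction B rule: finite_induct)
  case empty
  then show ?case by simp
next
  case (insert v B)
  have "B \<subseteq> X" using insert.prems by simp
  from insert.IH[OF insert.prems(1) this insert.prems(3)]
  obtain p where p: "\<forall>u\<in>B. 0 \<le> p u \<and> p u \<le> 1" "Z (X - B) = Z X * (\<Prod>u\<in>B. 1 - p u)"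
    "(\<Sum>j\<in>X. \<bar>marginal (X - B) j - marginal X j\<bar>) \<le> M * (\<Sum>u\<in>B. p u)"
    "(\<Sum>j\<in>X. \<bar>marginal (X - B) j - marginal X j\<bar>) \<le> real (card B) * K"
    by auto
  \<comment> \<open>The new vertex \<open>v\<close> is deleted last, so its marginal is taken in
    what remains after \<open>B\<close>.\<close>
  define Y where "Y = X - B"
  have Y: "finite Y" "v \<in> Y" "Y \<subseteq> X" using insert by (auto simp: Y_def)
  have XY: "X - insert v B = Y - {v}" by (auto simp: Y_def)
  define q where "q = p(v := marginal Y v)"
  have "(\<Sum>u\<in>B. q u) = (\<Sum>u\<in>B. p u)" "(\<Prod>u\<in>B. 1 - q u) = (\<Prod>u\<in>B. 1 - p u)"
    using insert.hyps by (auto simp: q_def intro!: sum.cong prod.cong)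
  then have q: "(\<Sum>u\<in>insert v B. q u) = marginal Y v + (\<Sum>u\<in>B. p u)"
    "(\<Prod>u\<in>insert v B. 1 - q u) = (1 - marginal Y v) * (\<Prod>u\<in>B. 1 - p u)"
    using insert.hyps by (simp_all add: q_def)
  have bounds: "\<forall>u\<in>insert v B. 0 \<le> q u \<and> q u \<le> 1"
    using p(1) marginal_bounds[OF Y(1)] by (auto simp: q_def)
  have "(\<Sum>j\<in>X. \<bar>marginal (Y - {v}) j - marginal X j\<bar>)
      \<le> (\<Sum>j\<in>X. \<bar>marginal (Y - {v}) j - marginal Y j\<bar> + \<bar>marginal Y j - marginal X j\<bar>)"
    by (intro sum_mono) linarith
  also have "\<dots> = (\<Sum>j\<in>X. \<bar>marginal (Y - {v}) j - marginal Y j\<bar>)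
      + (\<Sum>j\<in>X. \<bar>marginal Y j - marginal X j\<bar>)" by (rule sum.distrib)
  \<comment> \<open>Vertices of \<open>B\<close> have marginal 0 both in \<open>Y\<close> and in
    \<open>Y - {v}\<close>.\<close>
  also have "(\<Sum>j\<in>X. \<bar>marginal (Y - {v}) j - marginal Y j\<bar>)
      = (\<Sum>j\<in>Y. \<bar>marginal (Y - {v}) j - marginal Y j\<bar>)"
    using Y insert.prems(1) by (intro sum.mono_neutral_right) (auto simp: marginal_outside)
  also have "\<dots> = marginal Y v * total_influence Y v" by (rule sum_marginal_remove[OF Y(1,2)])
  finally have sum: "(\<Sum>j\<in>X. \<bar>marginal (Y - {v}) j - marginal X j\<bar>)
      \<le> marginal Y v * total_influence Y v + (\<Sum>j\<in>X. \<bar>marginal Y j - marginal X j\<bar>)" .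
  \<comment> \<open>The increment is charged in two ways: \<open>M\<close> keeps the marginals
    visible for AM-GM, \<open>K\<close> gives a bound by cardinality only.\<close>
  have bd: "total_influence Y v \<le> M" "marginal Y v * total_influence Y v \<le> K"
    using insert.prems(3)[OF Y(3) _ Y(2)] by auto
  then have "marginal Y v * total_influence Y v \<le> marginal Y v * M"
    using marginal_bounds[OF Y(1)] by (intro mult_left_mono) auto
  then have 1: "(\<Sum>j\<in>X. \<bar>marginal (Y - {v}) j - marginal X j\<bar>) \<le> M * (\<Sum>u\<in>insert v B. q u)"
    using sum p(3) unfolding q Y_def[symmetric] by (simp add: algebra_simps)
  have 2: "(\<Sum>j\<in>X. \<bar>marginal (Y - {v}) j - marginal X j\<bar>) \<le> real (card (insert v B)) * K"
    using sum p(4) bd insert.hyps unfolding Y_def[symmetric] by (simp add: algebra_simps)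
  have "Z (Y - {v}) = Z X * (\<Prod>u\<in>insert v B. 1 - q u)"
    unfolding q Z_remove[OF Y(1)] using p(2) by (simp add: Y_def)
  with bounds 1 2 show ?case unfolding XY by blast
qed

lemma marginal_total_influence_le:
  assumes W: "finite W" "v \<in> W"
    and x: "0 < x" "real d * x < 1" "x < 1" "lam * (1 - x) ^ (d + 1) = x"
    and p: "finite B" "card B \<le> d" "\<forall>u\<in>B. 0 \<le> p u \<and> p u \<le> 1"
    and Z: "Z (W - {v} - nbrs v) = Z (W - {v}) * (\<Prod>u\<in>B. 1 - p u)"
    and T: "total_influence W v \<le> 1 + 1 / (1 - real d * x) * (\<Sum>u\<in>B. p u)"
  shows "marginal W v * total_influence W v \<le> x * (1 / (1 - real d * x))"
proof -
  define R where "R = lam * (\<Prod>u\<in>B. 1 - p u)"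
  define s where "s = (\<Sum>u\<in>B. p u)"
  have R: "R \<ge> 0" unfolding R_def using lam_pos p(3) by (intro mult_nonneg_nonneg prod_nonneg) auto
  have "Z W = Z (W - {v}) * (1 + R)"
    using Z_recursion[OF W] unfolding Z R_def by (simp add: algebra_simps)
  then have m: "marginal W v = R / (1 + R)"
    using Z_pos[of "W - {v}"] W R unfolding marginal_def by (simp add: divide_simps)
  \<comment> \<open>AM-GM with mean \<open>a = 1 - x\<close>; the sum \<open>s\<close> in the first
    factor cancels against the sum of the \<open>p u\<close>.\<close>
  have "(1 - (real d + 1) * x + s) * (\<Prod>u\<in>B. 1 - p u) \<le> (1 - x) ^ (d + 1)"
    using p x unfolding s_def by (intro mult_prod_le_power_mean) (auto simp: algebra_simps)
  then have "lam * ((1 - (real d + 1) * x + s) * (\<Prod>u\<in>B. 1 - p u)) \<le> x"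
    using mult_left_mono[of _ _ lam] lam_pos x(4) by fastforce
  \<comment> \<open>Adding \<open>R * x\<close> to both sides.\<close>
  then have "R * (1 - real d * x + s) \<le> x * (1 + R)"
    unfolding R_def by (simp add: algebra_simps)
  then have "R / (1 + R) * ((1 - real d * x + s) / (1 - real d * x)) \<le> x / (1 - real d * x)"
    using R x by (simp add: divide_simps mult.commute)
  moreover have "(1 - real d * x + s) / (1 - real d * x) = 1 + 1 / (1 - real d * x) * s"
    using x by (simp add: field_simps)
  moreover have "marginal W v * total_influence W v \<le> R / (1 + R) * (1 + 1 / (1 - real d * x) * s)"
    unfolding m using T R unfolding s_def by (intro mult_left_mono) auto
  ultimately show ?thesis by simp
qed

text \<open>Both bounds are proved in one induction, since each of them at \<open>v\<close> rests on
  the bounds at its neighbours. The degree condition passes on to a neighbour \<open>u\<close>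
  because \<open>u\<close> loses \<open>v\<close> when \<open>v\<close> is deleted.\<close>

lemma total_influence_branch:
  assumes "finite V" "\<forall>u\<in>V. card (nbrs u \<inter> V) \<le> d + 1"
    and x: "0 < x" "real d * x < 1" "x < 1" "lam * (1 - x) ^ (d + 1) = x"
    and "W \<subseteq> V" "v \<in> W" "card (nbrs v \<inter> W) \<le> d"
  shows "total_influence W v \<le> 1 / (1 - real d * x)
    \<and> marginal W v * total_influence W v \<le> x * (1 / (1 - real d * x))"
  using assms(7-)
proof (induction "card W" arbitrary: W v rule: less_induct)
  case less
  define B where "B = nbrs v \<inter> W"
  define M where "M = 1 / (1 - real d * x)"
  have fin: "finite W" using less.prems assms(1) finite_subset by blast
  have B: "finite B" "B \<subseteq> W - {v}" "card B \<le> d" "W - {v} - B = W - {v} - nbrs v"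
    using fin not_in_own_nbrs less.prems by (auto simp: B_def)
  have "total_influence Y u \<le> M \<and> marginal Y u * total_influence Y u \<le> x * M"
    if "Y \<subseteq> W - {v}" "u \<in> B" "u \<in> Y" for Y u
  proof -
    have "v \<in> nbrs u \<inter> V" using that less.prems by (auto simp: B_def nbrs_sym)
    then have "card (nbrs u \<inter> Y) < card (nbrs u \<inter> V)"
      using that less.prems assms(1) by (intro psubset_card_mono) auto
    moreover have "card (nbrs u \<inter> V) \<le> d + 1" using assms(2) that less.prems by (auto simp: B_def)
    ultimately have "card (nbrs u \<inter> Y) \<le> d" by linarith
    moreover have "card Y < card W" using that fin less.prems by (intro psubset_card_mono) auto
    ultimately show ?thesis
      unfolding M_def using less.hyps[of Y u] that less.prems by auto
  qed
  from remove_set_marginals[OF B(1) _ B(2) this] fin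
  obtain p where p: "\<forall>u\<in>B. 0 \<le> p u \<and> p u \<le> 1"
    "Z (W - {v} - B) = Z (W - {v}) * (\<Prod>u\<in>B. 1 - p u)"
    "(\<Sum>j\<in>W - {v}. \<bar>marginal (W - {v} - B) j - marginal (W - {v}) j\<bar>) \<le> M * (\<Sum>u\<in>B. p u)"
    "(\<Sum>j\<in>W - {v}. \<bar>marginal (W - {v} - B) j - marginal (W - {v}) j\<bar>) \<le> real (card B) * (x * M)"
    by auto
  have T: "total_influence W v \<le> 1 + M * (\<Sum>u\<in>B. p u)"
    using p(3) unfolding total_influence_def B(4) by linarith
  have "real (card B) * (x * M) \<le> real d * (x * M)"
    using B(3) x by (intro mult_right_mono) (auto simp: M_def)
  then have "total_influence W v \<le> 1 + real d * (x * M)"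
    using p(4) unfolding total_influence_def B(4) by linarith
  also have "\<dots> = M" using x by (simp add: M_def field_simps)
  finally have "total_influence W v \<le> M" .
  moreover have "marginal W v * total_influence W v \<le> x * M"
    using marginal_total_influence_le[OF fin less.prems(2) x B(1,3) p(1)] p(2) T
    unfolding M_def B(4) by blast
  ultimately show ?case by (simp add: M_def)
qed

text \<open>Only the starting vertex can have \<open>d + 1\<close> neighbours; after its deletion
  each of them satisfies the branch bound, so no further induction is required.\<close>

lemma total_influence_le:
  assumes V: "finite V" "\<forall>u\<in>V. card (nbrs u \<inter> V) \<le> d + 1"
    and x: "0 < x" "real d * x < 1" "x < 1" "lam * (1 - x) ^ (d + 1) = x"
    and W: "W \<subseteq> V" "v \<in> W"
  shows "total_influence W v \<le> (1 + x) / (1 - real d * x)"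
proof -
  define B where "B = nbrs v \<inter> W"
  define M where "M = 1 / (1 - real d * x)"
  have fin: "finite W" using W V finite_subset by blast
  have "card B \<le> card (nbrs v \<inter> V)" unfolding B_def using V W by (intro card_mono) auto
  then have B: "finite B" "B \<subseteq> W - {v}" "card B \<le> d + 1" "W - {v} - B = W - {v} - nbrs v"
    using fin not_in_own_nbrs V W by (force simp: B_def)+
  have "total_influence Y u \<le> M \<and> marginal Y u * total_influence Y u \<le> x * M"
    if "Y \<subseteq> W - {v}" "u \<in> B" "u \<in> Y" for Y u
  proof -
    have "v \<in> nbrs u \<inter> V" using that W by (auto simp: B_def nbrs_sym)
    then have "card (nbrs u \<inter> Y) < card (nbrs u \<inter> V)"
      using that V W by (intro psubset_card_mono) auto
    moreover have "card (nbrs u \<inter> V) \<le> d + 1" using V that W by (auto simp: B_def)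
    ultimately have "card (nbrs u \<inter> Y) \<le> d" by linarith
    then show ?thesis
      unfolding M_def using total_influence_branch[OF V x, of Y u] that W by auto
  qed
  from remove_set_marginals[OF B(1) _ B(2) this] fin
  have "(\<Sum>j\<in>W - {v}. \<bar>marginal (W - {v} - B) j - marginal (W - {v}) j\<bar>) \<le> real (card B) * (x * M)"
    by auto
  also have "\<dots> \<le> real (d + 1) * (x * M)"
    using B(3) x by (intro mult_right_mono) (auto simp: M_def)
  finally have "total_influence W v \<le> 1 + real (d + 1) * (x * M)"
    unfolding total_influence_def B(4) by linarith
  also have "\<dots> = (1 + x) / (1 - real d * x)" using x by (simp add: M_def field_simps)
  finally show ?thesis .
qed

lemma card_nbrs_le_vertex_degree:
  assumes "finite E"
  shows "card (nbrs v \<inter> V) \<le> vertex_degree E v"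
  unfolding vertex_degree_def using assms
  by (intro card_inj_on_le[where f = "\<lambda>u. {v, u}"])
     (auto simp: nbrs_def inj_on_def doubleton_eq_iff)

end

section \<open>Pinned hardcore distributions\<close>

locale hardcore_model = hardcore_weights E lam
  for E :: "'a set set" and lam :: real +
  fixes V :: "'a set"
  assumes graph: "simple_graph V E"
begin

lemma finite_V: "finite V"
  using graph by (simp add: simple_graph_def)

lemma prob_hardcore:
  "measure_pmf.prob (hardcore V E lam) A
    = (\<Sum>S\<in>{S\<in>indep_sets_of V E. (\<lambda>v. v \<in> S) \<in> A}. lam ^ card S) / Z V"
proof -
  let ?\<mu> = "hardcore V E lam" and ?I = "{S\<in>indep_sets_of V E. (\<lambda>v. v \<in> S) \<in> A}"
  let ?C = "(\<lambda>S v. v \<in> S) ` ?I"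
  have fin: "finite ?I" using finite_indep_sets[OF finite_V] by simp
  have "measure_pmf.prob ?\<mu> A = measure_pmf.prob ?\<mu> ?C"
  proof (rule measure_eq_AE)
    show "AE \<sigma> in measure_pmf ?\<mu>. \<sigma> \<in> A \<longleftrightarrow> \<sigma> \<in> ?C"
    proof (rule AE_pmfI)
      fix \<sigma> assume "\<sigma> \<in> set_pmf ?\<mu>"
      then have "{v. \<sigma> v} \<in> indep_sets_of V E"
        by (auto simp: set_pmf_iff pmf_hardcore[OF graph lam_pos] split: if_splits)
      then show "\<sigma> \<in> A \<longleftrightarrow> \<sigma> \<in> ?C" by (auto intro!: image_eqI[of _ _ "{v. \<sigma> v}"])
    qed
  qed auto
  also have "\<dots> = (\<Sum>\<sigma>\<in>?C. pmf ?\<mu> \<sigma>)" using fin by (intro measure_measure_pmf_finite) simp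
  also have "\<dots> = (\<Sum>S\<in>?I. pmf ?\<mu> (\<lambda>v. v \<in> S))"
    by (subst sum.reindex) (auto simp: inj_on_def fun_eq_iff)
  also have "\<dots> = (\<Sum>S\<in>?I. lam ^ card S / Z V)"
    by (intro sum.cong) (auto simp: pmf_hardcore[OF graph lam_pos])
  finally show ?thesis by (simp add: sum_divide_distrib)
qed

end

locale pinned_hardcore = hardcore_model +
  fixes \<Lambda> :: "'a set" and \<tau> :: "'a \<Rightarrow> bool"
  assumes pin: "pinning V (hardcore V E lam) \<Lambda> \<tau>"
begin

definition occupied :: "'a set" where
  "occupied = {v \<in> \<Lambda>. \<tau> v}"

text \<open>The vertices that the pinning leaves undecided; conditioning amounts to the hardcore
  model on the subgraph they induce.\<close>

definition unblocked :: "'a set" where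
  "unblocked = V - \<Lambda> - (\<Union>v\<in>occupied. nbrs v)"

abbreviation \<mu> :: "('a \<Rightarrow> bool) pmf" where
  "\<mu> \<equiv> pinned (hardcore V E lam) \<Lambda> \<tau>"

lemma unblocked_finite: "finite unblocked"
  using finite_V by (simp add: unblocked_def)

lemma agreeing_iff: "(\<lambda>v. v \<in> S) \<in> agreeing \<Lambda> \<tau> \<longleftrightarrow> S \<inter> \<Lambda> = occupied"
  by (auto simp: agreeing_def occupied_def)

text \<open>A pinning of positive probability is extended by some independent set, and
  \<open>occupied\<close> is a subset of it.\<close>

lemma occupied_indep: "occupied \<in> indep_sets_of V E"
proof -
  have "measure_pmf.prob (hardcore V E lam) (agreeing \<Lambda> \<tau>) \<noteq> 0"
    using pin by (simp add: pinning_def)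
  then have "{S\<in>indep_sets_of V E. S \<inter> \<Lambda> = occupied} \<noteq> {}"
    unfolding prob_hardcore agreeing_iff by (metis div_0 sum.empty)
  then show ?thesis by (auto simp: indep_sets_of_def intro: smaller_indep)
qed

text \<open>Removing \<open>\<Lambda>\<close> and adding \<open>occupied\<close> are inverse
  bijections, and the pinned part contributes a constant factor. With \<open>Q\<close> arbitrary,
  this yields numerator and denominator of every conditional probability.\<close>

lemma sum_agreeing:
  "(\<Sum>S\<in>{S\<in>indep_sets_of V E. S \<inter> \<Lambda> = occupied \<and> Q S}. lam ^ card S)
    = lam ^ card occupied
      * (\<Sum>S\<in>{S\<in>indep_sets_of unblocked E. Q (S \<union> occupied)}. lam ^ card S)"
proof -
  have occ: "occupied \<subseteq> V" "occupied \<subseteq> \<Lambda>" "\<And>v. v \<in> occupied \<Longrightarrow> occupied \<inter> nbrs v = {}"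
    using occupied_indep by (auto simp: indep_sets_of_def indep_iff_nbrs occupied_def)
  have "(\<Sum>S\<in>{S\<in>indep_sets_of V E. S \<inter> \<Lambda> = occupied \<and> Q S}. lam ^ card S)
      = (\<Sum>S\<in>{S\<in>indep_sets_of unblocked E. Q (S \<union> occupied)}. lam ^ card (S \<union> occupied))"
  proof (rule sum.reindex_bij_witness[where i = "\<lambda>S. S \<union> occupied" and j = "\<lambda>S. S - \<Lambda>"])
    fix S assume S: "S \<in> {S\<in>indep_sets_of V E. S \<inter> \<Lambda> = occupied \<and> Q S}"
    then show eq: "S - \<Lambda> \<union> occupied = S" by auto
    have "S \<inter> nbrs v = {}" if "v \<in> occupied" for v
      using S that by (auto simp: indep_sets_of_def indep_iff_nbrs)
    then have "S - \<Lambda> \<subseteq> unblocked" using S by (auto simp: unblocked_def indep_sets_of_def)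
    moreover have "indep (S - \<Lambda>) E"
      using S by (auto simp: indep_sets_of_def intro: smaller_indep)
    ultimately show "S - \<Lambda> \<in> {S \<in> indep_sets_of unblocked E. Q (S \<union> occupied)}"
      using S eq by (simp add: indep_sets_of_def)
    show "lam ^ card (S - \<Lambda> \<union> occupied) = lam ^ card S" by (simp only: eq)
  next
    fix S assume S: "S \<in> {S \<in> indep_sets_of unblocked E. Q (S \<union> occupied)}"
    then have sub: "S \<subseteq> unblocked" and ind: "\<And>v. v \<in> S \<Longrightarrow> S \<inter> nbrs v = {}"
      by (auto simp: indep_sets_of_def indep_iff_nbrs)
    show "S \<union> occupied - \<Lambda> = S" using sub occ by (auto simp: unblocked_def)
    have no: "u \<notin> nbrs v" "v \<notin> nbrs u" if "v \<in> occupied" "u \<in> S" for u v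
      using that sub nbrs_sym by (auto simp: unblocked_def)
    have "indep (S \<union> occupied) E"
      unfolding indep_iff_nbrs using ind occ(3) no by blast
    moreover have "S \<union> occupied \<subseteq> V" "(S \<union> occupied) \<inter> \<Lambda> = occupied"
      using sub occ by (auto simp: unblocked_def)
    ultimately show "S \<union> occupied \<in> {S \<in> indep_sets_of V E. S \<inter> \<Lambda> = occupied \<and> Q S}"
      using S by (simp add: indep_sets_of_def)
  qed
  also have "\<dots> = (\<Sum>S\<in>{S\<in>indep_sets_of unblocked E. Q (S \<union> occupied)}.
      lam ^ card occupied * lam ^ card S)"
  proof (rule sum.cong)
    fix S assume "S \<in> {S\<in>indep_sets_of unblocked E. Q (S \<union> occupied)}"
    then have "S \<subseteq> unblocked" by (simp add: indep_sets_of_def)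
    then have "finite S" "finite occupied" "S \<inter> occupied = {}"
      using finite_V occ by (auto simp: unblocked_def intro: finite_subset)
    then show "lam ^ card (S \<union> occupied) = lam ^ card occupied * lam ^ card S"
      by (simp add: card_Un_disjoint power_add)
  qed simp
  finally show ?thesis by (simp add: sum_distrib_left)
qed

lemma prob_pinned:
  "measure_pmf.prob \<mu> {\<sigma>. Q \<sigma>}
    = (\<Sum>S\<in>{S\<in>indep_sets_of unblocked E. Q (\<lambda>v. v \<in> S \<union> occupied)}. lam ^ card S) / Z unblocked"
proof -
  let ?\<nu> = "hardcore V E lam"
  have pos: "measure_pmf.prob ?\<nu> (agreeing \<Lambda> \<tau>) > 0" using pin by (simp add: pinning_def)
  have ne: "set_pmf ?\<nu> \<inter> agreeing \<Lambda> \<tau> \<noteq> {}"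
    using pos measure_Int_set_pmf[of ?\<nu> "agreeing \<Lambda> \<tau>"] by (auto simp: Int_commute)
  have "measure_pmf.prob \<mu> {\<sigma>. Q \<sigma>}
      = measure_pmf.prob ?\<nu> (agreeing \<Lambda> \<tau> \<inter> {\<sigma>. Q \<sigma>}) / measure_pmf.prob ?\<nu> (agreeing \<Lambda> \<tau>)"
    unfolding pinned_def cond_pmf.rep_eq[OF ne] using pos
    by (subst measure_uniform_measure) (auto simp: measure_pmf.emeasure_eq_measure)
  moreover have "measure_pmf.prob ?\<nu> (agreeing \<Lambda> \<tau> \<inter> {\<sigma>. Q \<sigma>}) = lam ^ card occupied
      * (\<Sum>S\<in>{S\<in>indep_sets_of unblocked E. Q (\<lambda>v. v \<in> S \<union> occupied)}. lam ^ card S) / Z V"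
    using sum_agreeing[of "\<lambda>S. Q (\<lambda>v. v \<in> S)"] by (simp add: prob_hardcore agreeing_iff)
  moreover have "measure_pmf.prob ?\<nu> (agreeing \<Lambda> \<tau>) = lam ^ card occupied * Z unblocked / Z V"
    using sum_agreeing[of "\<lambda>_. True"]
    by (simp add: prob_hardcore agreeing_iff partition_function_def[of unblocked])
  ultimately show ?thesis
    using lam_pos Z_pos[OF finite_V] by simp
qed

section \<open>Marginals and influences under a pinning\<close>

lemma unblocked_not_occupied: "v \<in> unblocked \<Longrightarrow> v \<notin> occupied"
  by (auto simp: unblocked_def occupied_def)

lemma prob_occupied:
  assumes "i \<in> unblocked"
  shows "measure_pmf.prob \<mu> {\<sigma>. \<sigma> i} = lam * Z (unblocked - {i} - nbrs i) / Z unblocked"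
  using weight_containing[OF unblocked_finite assms] unblocked_not_occupied[OF assms]
  by (simp add: prob_pinned)

lemma prob_unoccupied:
  assumes "i \<in> unblocked"
  shows "measure_pmf.prob \<mu> {\<sigma>. \<not> \<sigma> i} = Z (unblocked - {i}) / Z unblocked"
  using unblocked_not_occupied[OF assms]
  by (simp add: prob_pinned sum_indep_sets_avoiding partition_function_def)

text \<open>Once \<open>i\<close> is occupied, an independent subset of \<open>Y\<close> remains,
  and those containing \<open>j\<close> weigh \<open>Z Y - Z (Y - {j})\<close>. This is 0 for
  \<open>j\<close> adjacent to \<open>i\<close>, as then \<open>j\<close> is not in
  \<open>Y\<close>.\<close>

lemma prob_both_occupied:
  assumes "i \<in> unblocked" "j \<in> unblocked" "i \<noteq> j"
  defines "Y \<equiv> unblocked - {i} - nbrs i"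
  shows "measure_pmf.prob \<mu> {\<sigma>. \<sigma> j \<and> \<sigma> i} = lam * (Z Y - Z (Y - {j})) / Z unblocked"
proof -
  have fin: "finite Y" using unblocked_finite by (simp add: Y_def)
  have "(\<Sum>S\<in>{S\<in>indep_sets_of unblocked E. j \<in> S \<and> i \<in> S}. lam ^ card S)
      = (\<Sum>S\<in>{S\<in>indep_sets_of unblocked E. i \<in> S}. if j \<in> S then lam ^ card S else 0)"
    using finite_indep_sets[OF unblocked_finite]
    by (subst sum.inter_filter[symmetric]) (auto intro!: sum.cong)
  also have "\<dots> = (\<Sum>S\<in>indep_sets_of Y E. if j \<in> S then lam * lam ^ card S else 0)"
    unfolding sum_indep_sets_containing[OF assms(1)] Y_def[symmetric]
  proof (rule sum.cong)
    fix S assume "S \<in> indep_sets_of Y E"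
    then have "i \<notin> S" "finite S"
      using fin by (auto simp: Y_def indep_sets_of_def intro: finite_subset)
    then show "(if j \<in> insert i S then lam ^ card (insert i S) else 0)
        = (if j \<in> S then lam * lam ^ card S else 0)"
      using assms(3) by simp
  qed simp
  also have "\<dots> = lam * (\<Sum>S\<in>{S\<in>indep_sets_of Y E. j \<in> S}. lam ^ card S)"
    using finite_indep_sets[OF fin] by (simp add: sum.inter_filter[symmetric] sum_distrib_left)
  finally show ?thesis
    using unblocked_not_occupied assms(1,2)
    by (simp add: prob_pinned weight_containing_eq_diff[OF fin])
qed

lemma prob_only_occupied:
  assumes "i \<in> unblocked" "j \<in> unblocked"
  shows "measure_pmf.prob \<mu> {\<sigma>. \<sigma> j \<and> \<not> \<sigma> i}
    = (Z (unblocked - {i}) - Z (unblocked - {i} - {j})) / Z unblocked"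
proof -
  have "{S\<in>indep_sets_of unblocked E. j \<in> S \<and> i \<notin> S}
      = {S\<in>indep_sets_of (unblocked - {i}) E. j \<in> S}"
    by (auto simp: indep_sets_of_def)
  then show ?thesis
    using unblocked_not_occupied assms unblocked_finite
    by (simp add: prob_pinned weight_containing_eq_diff)
qed

text \<open>Outside \<open>unblocked\<close> the value of a coordinate is decided by membership in
  \<open>occupied\<close>, so one of its two values has probability 0.\<close>

lemma free_coords_eq: "free_coords V \<mu> = unblocked"
proof (intro set_eqI iffI)
  fix i assume i: "i \<in> free_coords V \<mu>"
  show "i \<in> unblocked"
  proof (rule ccontr)
    assume "i \<notin> unblocked"
    then have "i \<in> S \<union> occupied \<longleftrightarrow> i \<in> occupied" if "S \<in> indep_sets_of unblocked E" for S
      using that by (auto simp: indep_sets_of_def)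
    then have "{S\<in>indep_sets_of unblocked E. i \<in> S \<union> occupied} = {}
        \<or> {S\<in>indep_sets_of unblocked E. i \<notin> S \<union> occupied} = {}" by blast
    then have "measure_pmf.prob \<mu> {\<sigma>. \<sigma> i} = 0 \<or> measure_pmf.prob \<mu> {\<sigma>. \<not> \<sigma> i} = 0"
      by (elim disjE) (simp_all only: prob_pinned sum.empty div_0 simp_thms)
    then show False using i by (auto simp: free_coords_def)
  qed
next
  fix i assume i: "i \<in> unblocked"
  then have "i \<in> V" by (simp add: unblocked_def)
  then show "i \<in> free_coords V \<mu>"
    using i unblocked_finite lam_pos
    by (simp add: free_coords_def prob_occupied prob_unoccupied Z_pos)
qed

lemma influence_self:
  assumes "i \<in> unblocked"
  shows "influence \<mu> i i = 1"
  using assms unblocked_finite lam_pos Z_pos[of "unblocked - {i} - nbrs i"] Z_pos[of unblocked]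
  by (simp add: influence_def cond_prob_def prob_occupied)

lemma influence_other:
  assumes "i \<in> unblocked" "j \<in> unblocked" "i \<noteq> j"
  shows "influence \<mu> i j
    = marginal (unblocked - {i} - nbrs i) j - marginal (unblocked - {i}) j"
proof -
  have pos: "Z unblocked > 0" "Z (unblocked - {i}) > 0" "Z (unblocked - {i} - nbrs i) > 0"
    using unblocked_finite by (auto intro: Z_pos)
  show ?thesis
    using assms pos lam_pos
    by (simp add: influence_def cond_prob_def prob_occupied prob_unoccupied prob_both_occupied
        prob_only_occupied marginal_def) (simp add: field_simps)
qed

text \<open>Reduces spectral independence under every pinning to the bound on
  \<open>total_influence\<close> in induced subgraphs.\<close>

lemma sum_influence:
  assumes "i \<in> unblocked"
  shows "(\<Sum>j\<in>free_coords V \<mu>. \<bar>influence \<mu> i j\<bar>) = total_influence unblocked i"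
proof -
  have "(\<Sum>j\<in>unblocked. \<bar>influence \<mu> i j\<bar>)
      = \<bar>influence \<mu> i i\<bar> + (\<Sum>j\<in>unblocked - {i}. \<bar>influence \<mu> i j\<bar>)"
    using assms unblocked_finite by (simp add: sum.remove)
  also have "(\<Sum>j\<in>unblocked - {i}. \<bar>influence \<mu> i j\<bar>) = (\<Sum>j\<in>unblocked - {i}.
      \<bar>marginal (unblocked - {i} - nbrs i) j - marginal (unblocked - {i}) j\<bar>)"
    using assms by (intro sum.cong) (auto simp: influence_other)
  finally show ?thesis
    by (simp add: free_coords_eq total_influence_def influence_self[OF assms])
qed

end

lemma (in hardcore_model) linf_spectral_independence_hardcore:
  assumes deg: "\<forall>v\<in>V. vertex_degree E v \<le> d + 1"
    and x: "0 < x" "real d * x < 1" "x < 1" "lam * (1 - x) ^ (d + 1) = x"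
  shows "linf_spectral_independence V (hardcore V E lam) ((1 + x) / (1 - real d * x))"
  unfolding linf_spectral_independence_def
proof (intro allI impI ballI)
  fix \<Lambda> \<tau> i
  assume pin: "pinning V (hardcore V E lam) \<Lambda> \<tau>"
    and i: "i \<in> free_coords V (pinned (hardcore V E lam) \<Lambda> \<tau>)"
  interpret pinned_hardcore E lam V \<Lambda> \<tau> by unfold_locales (rule pin)
  have "E \<subseteq> Pow V" using graph by (auto simp: simple_graph_def)
  then have "finite E" using finite_V by (meson finite_Pow_iff finite_subset)
  then have "\<forall>u\<in>V. card (nbrs u \<inter> V) \<le> d + 1"
    using deg card_nbrs_le_vertex_degree order_trans by blast
  moreover have "unblocked \<subseteq> V" by (auto simp: unblocked_def)
  moreover have "i \<in> unblocked" using i by (simp add: free_coords_eq)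
  ultimately show "(\<Sum>j\<in>free_coords V \<mu>. \<bar>influence \<mu> i j\<bar>) \<le> (1 + x) / (1 - real d * x)"
    using total_influence_le[OF finite_V _ x] by (simp add: sum_influence)
qed

theorem theorem3p1:
  fixes V :: "'a set" and E :: "'a set set" and d \<Delta> :: nat and \<delta> lam :: real
  assumes "\<Delta> = d + 1" and "\<Delta> \<ge> 3"
    and "0 < \<delta>" and "\<delta> < 1"
    and "simple_graph V E"
    and "\<forall>v\<in>V. vertex_degree E v \<le> \<Delta>"
    and "lam = (1 - \<delta>) * lambda_c \<Delta>"
  shows "(\<exists>!x. x \<in> {0..1} \<and> F_hc d lam x = x)
    \<and> xhat d lam \<in> {0<..<1 / real d}
    \<and> linf_spectral_independence V (hardcore V E lam)
        ((1 + xhat d lam) / (1 - real d * xhat d lam))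
    \<and> (1 + xhat d lam) / (1 - real d * xhat d lam) \<le> 2 / \<delta> * (1 + 2 / (real d - 1))"
proof -
  have d: "d \<ge> 2" using assms by simp
  have lam: "0 < lam" "lam < lambda_c (d + 1)"
    using lambda_c_pos[OF d] assms by auto
  obtain x where x: "x \<in> {0<..<1 / real d}" "lam * (1 - x) ^ (d + 1) = x"
    and fixed: "\<And>y. y \<in> {0..1} \<Longrightarrow> F_hc d lam y = y \<longleftrightarrow> y = x"
    using fixed_point_unique_exists[OF d lam] by metis
  have "1 / real d \<le> 1" using d by simp
  then have x1: "0 < x" "x < 1" using x(1) by auto
  have dx: "real d * x < 1" using x(1) d by (simp add: field_simps)
  \<comment> \<open>This form gives both the uniqueness claim and the value of the definite
    description in \<open>xhat\<close>.\<close>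
  have iff: "y \<in> {0..1} \<and> F_hc d lam y = y \<longleftrightarrow> y = x" for y
    using fixed[of y] x1 by auto
  then have xhat: "xhat d lam = x" by (simp add: xhat_def)
  interpret hardcore_model E lam V
    using assms lam by unfold_locales (auto simp: simple_graph_def)
  have "linf_spectral_independence V (hardcore V E lam) ((1 + x) / (1 - real d * x))"
    using assms(1,6) by (intro linf_spectral_independence_hardcore x1 dx x(2)) simp
  moreover have "(1 + x) / (1 - real d * x) \<le> 2 / \<delta> * (1 + 2 / (real d - 1))"
    using spectral_constant_le[OF d assms(3,4) x(1)] x(2) assms(1,7) by simp
  ultimately show ?thesis using x(1) iff xhat by simp
qed

end
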